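(* Let $k\ge 1$. The numbers $S_{k}(n;m',u')$ with $m',u'\in\{0,1\}$ enumerate the following combinatorial objects. (1) $S_{k}(n;0,0)=|\mathtt{Dyck}(n;k)|$, which is the Fuss–Catalan number $\frac{1}{kn+1}\binom{(k+1)n}{n}$. (2) $S_{k}(n;0,1)=2^{n}|\mathtt{Dyck}(n;k)|$, namely the number of $k$-Dyck paths of size $n$ with two colors for each up step. (3) $S_{k}(n;1,0)$ is the number of $k$-Schröder paths of type A of size $n$, that is, $|\mathtt{Sch}^{A}(n;k)|$. (4) $S_{k}(n;1,1)$ is the weighted number of $k$-Dyck paths $\mu$ of size $n$ in which each up step beginning a pattern $UD^{k}$ has weight $4$ and each other up step has weight $3$ (the weight of $\mu$ being the product of the weights of its up steps).
   Context: Let $\nu(m,r,s,u)$ be the formal power series in $r$ satisfying $f(rs)\nu(m,r,s,u)=1-g(rs)\prod_{j=0}^{k}\nu(m,rs^{j},s,u)$, where $f(x)=1+x(m-1)$ and $g(x)=x(m(u-1)+1)$. With $m'=m-1$ and $u'=u-1$, the numbers $S_k(n;m',u')$ are defined by the expansion at $s=1$: $\nu(m,r,1,u)=\sum_{n\ge 0}(-r)^{n}S_{k}(n;m',u')$. A $k$-Dyck path of size $n$ is a lattice path from $(0,0)$ to $(kn,n)$ consisting of up steps $U=(0,1)$ and down steps $D=(1,0)$ which never goes below the line $y=x/k$; $\mathtt{Dyck}(n;k)$ is the set of them. A $k$-Schröder path of type A of size $n$ is a lattice path from $(0,0)$ to $(kn,n)$ with steps $U=(0,1)$, $D=(1,0)$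 and $H=(k,1)$, which never goes below $y=x/k$; $\mathtt{Sch}^{A}(n;k)$ is the set of them. *)

theory Defs
  imports
    Complex_Main
    "HOL-Library.FuncSet"
    "HOL-Computational_Algebra.Formal_Power_Series"
begin

section \<open>The power series \<open>\<nu>(m,r,s,u)\<close>\<close>

text \<open>
  The formal variable \<open>r\<close> is \<^const>\<open>fps_X\<close>; \<open>m\<close>, \<open>s\<close>, \<open>u\<close> are elements of an arbitrary
  commutative coefficient ring (which may be a polynomial ring with \<open>m\<close>, \<open>s\<close>, \<open>u\<close> its
  indeterminates). Hence \<open>\<nu>(m, r s\<^sup>j, s, u)\<close> is the composition of \<open>\<nu>\<close> with \<open>s\<^sup>j r\<close>.
\<close>

definition f_fun :: "'a::comm_ring_1 \<Rightarrow> 'a \<Rightarrow> 'a" where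
  "f_fun m x = 1 + x * (m - 1)"

definition g_fun :: "'a::comm_ring_1 \<Rightarrow> 'a \<Rightarrow> 'a \<Rightarrow> 'a" where
  "g_fun m u x = x * (m * (u - 1) + 1)"

definition nu_equation :: "nat \<Rightarrow> 'a::comm_ring_1 \<Rightarrow> 'a \<Rightarrow> 'a \<Rightarrow> 'a fps \<Rightarrow> bool" where
  "nu_equation k m s u F \<longleftrightarrow>
     f_fun (fps_const m) (fps_const s * fps_X) * F =
     1 - g_fun (fps_const m) (fps_const u) (fps_const s * fps_X) *
           (\<Prod>j=0..k. F oo (fps_const (s ^ j) * fps_X))"

definition nu :: "nat \<Rightarrow> 'a::comm_ring_1 \<Rightarrow> 'a \<Rightarrow> 'a \<Rightarrow> 'a fps" where
  "nu k m s u = (THE F. nu_equation k m s u F)"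

definition S_num :: "nat \<Rightarrow> nat \<Rightarrow> 'a::comm_ring_1 \<Rightarrow> 'a \<Rightarrow> 'a" where
  "S_num k n m' u' = (-1) ^ n * fps_nth (nu k (m' + 1) 1 (u' + 1)) n"

text \<open>The definite description is justified: the equation has exactly one solution.\<close>

definition nu_step :: "nat \<Rightarrow> 'a::comm_ring_1 \<Rightarrow> 'a \<Rightarrow> 'a \<Rightarrow> 'a fps \<Rightarrow> 'a fps" where
  "nu_step k m s u F = 1 - fps_X * (fps_const (s * (m - 1)) * F +
     fps_const (s * (m * (u - 1) + 1)) * (\<Prod>j=0..k. F oo (fps_const (s ^ j) * fps_X)))"

lemma nu_equation_iff_fixpoint: "nu_equation k m s u F \<longleftrightarrow> F = nu_step k m s u F"
proof -
  define P where "P = (\<Prod>j=0..k. F oo (fps_const (s ^ j) * fps_X))"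
  have c: "fps_const (s * (m - 1)) = fps_const s * (fps_const m - 1)"
    by (simp flip: fps_const_1_eq_1 add: fps_const_mult fps_const_sub)
  have d: "fps_const (s * (m * (u - 1) + 1)) =
      fps_const s * (fps_const m * (fps_const u - 1) + 1)"
    by (simp flip: fps_const_1_eq_1 add: fps_const_mult fps_const_sub fps_const_add)
  have ring: "(1 + S * X * (M - 1)) * F - (1 - S * X * (M * (V - 1) + 1) * P) =
      F - (1 - X * (S * (M - 1) * F + S * (M * (V - 1) + 1) * P))" for S X M V P :: "'a fps"
    by (simp add: algebra_simps)
  have "f_fun (fps_const m) (fps_const s * fps_X) * F -
      (1 - g_fun (fps_const m) (fps_const u) (fps_const s * fps_X) * P) =
      F - (1 - fps_X * (fps_const (s * (m - 1)) * F + fps_const (s * (m * (u - 1) + 1)) * P))"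
    unfolding f_fun_def g_fun_def c d by (rule ring)
  then show ?thesis
    unfolding nu_equation_def nu_step_def P_def[symmetric]
    by (metis eq_iff_diff_eq_0)
qed

lemma fps_mult_nth_cong:
  assumes "\<And>i. i < n \<Longrightarrow> fps_nth A i = fps_nth B i" "\<And>i. i < n \<Longrightarrow> fps_nth C i = fps_nth D i" "i < n"
  shows "fps_nth (A * C :: 'a::comm_ring_1 fps) i = fps_nth (B * D) i"
  unfolding fps_mult_nth using assms by (intro sum.cong) auto

lemma fps_prod_nth_cong:
  assumes "finite J"
    and "\<And>j i. j \<in> J \<Longrightarrow> i < n \<Longrightarrow> fps_nth (A j) i = fps_nth (B j) i" "i < n"
  shows "fps_nth (\<Prod>j\<in>J. A j :: 'a::comm_ring_1 fps) i = fps_nth (\<Prod>j\<in>J. B j) i"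
  using assms
proof (induction J arbitrary: i rule: finite_induct)
  case (insert j J)
  have "fps_nth (A j * prod A J) i = fps_nth (B j * prod B J) i"
  proof (rule fps_mult_nth_cong)
    show "fps_nth (A j) l = fps_nth (B j) l" if "l < n" for l
      using insert.prems that by simp
    show "fps_nth (prod A J) l = fps_nth (prod B J) l" if "l < n" for l
      using insert.IH insert.prems that by simp
  qed (rule insert.prems(2))
  then show ?case
    using insert.hyps by simp
qed simp

lemma nu_step_contractive:
  assumes "\<And>i. i < n \<Longrightarrow> fps_nth F i = fps_nth G i" "i < Suc n"
  shows "fps_nth (nu_step k m s u F) i = fps_nth (nu_step k m s u G) i"
proof (cases i)
  case (Suc l)
  then have l: "l < n" using assms(2) by simp
  have "fps_nth (\<Prod>j=0..k. F oo (fps_const (s ^ j) * fps_X)) l =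
        fps_nth (\<Prod>j=0..k. G oo (fps_const (s ^ j) * fps_X)) l"
    using l assms(1) by (intro fps_prod_nth_cong[where n = n]) auto
  then show ?thesis
    using Suc l assms(1) by (simp add: nu_step_def)
qed (simp add: nu_step_def)

lemma ex1_nu_equation: "\<exists>!F. nu_equation k m s u F"
proof -
  let ?T = "nu_step k m s u"
  have unique: "F = G" if "F = ?T F" "G = ?T G" for F G
  proof -
    have "\<forall>i<n. fps_nth F i = fps_nth G i" for n
    proof (induction n)
      case (Suc n)
      then show ?case
        using nu_step_contractive[of n F G _ k m s u] that by metis
    qed simp
    then show ?thesis by (auto simp: fps_eq_iff)
  qed
  have stable: "fps_nth ((?T ^^ n) (?T G)) i = fps_nth ((?T ^^ n) G) i" if "i < n" for n i G
    using that
  proof (induction n arbitrary: i)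
    case (Suc n)
    have "fps_nth (?T ((?T ^^ n) (?T G))) i = fps_nth (?T ((?T ^^ n) G)) i"
      by (rule nu_step_contractive[where n = n]) (use Suc in auto)
    then show ?case by simp
  qed simp
  define F where "F = Abs_fps (\<lambda>n. fps_nth ((?T ^^ Suc n) 0) n)"
  have lim: "fps_nth ((?T ^^ n) 0) i = fps_nth F i" if "i < n" for n i
    using that
  proof (induction n)
    case (Suc n)
    show ?case
    proof (cases "i = n")
      case False
      then have "i < n" using Suc.prems by simp
      then show ?thesis using Suc.IH stable[of i n 0] by (simp add: funpow_swap1)
    qed (simp add: F_def)
  qed simp
  have "fps_nth F n = fps_nth (?T F) n" for n
    using lim[of n "Suc n"] nu_step_contractive[of n "(?T ^^ n) 0" F n k m s u] lim by auto
  then have "F = ?T F" by (simp add: fps_eq_iff)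
  then show ?thesis using unique by (auto simp: nu_equation_iff_fixpoint)
qed

lemma nu_equation_nu: "nu_equation k m s u (nu k m s u)"
  unfolding nu_def by (rule theI') (rule ex1_nu_equation)


section \<open>Lattice paths\<close>

datatype step = U | D | H

fun step_x :: "nat \<Rightarrow> step \<Rightarrow> nat" where
  "step_x k U = 0"
| "step_x k D = 1"
| "step_x k H = k"

fun step_y :: "step \<Rightarrow> nat" where
  "step_y U = 1"
| "step_y D = 0"
| "step_y H = 1"

definition path_x :: "nat \<Rightarrow> step list \<Rightarrow> nat" where
  "path_x k p = sum_list (map (step_x k) p)"

definition path_y :: "step list \<Rightarrow> nat" where
  "path_y p = sum_list (map step_y p)"

text \<open>
  A path starts at the origin and is given by its list of steps. As its segments are straight,
  it stays weakly above the line \<open>y = x/k\<close> iff its vertices (the end points of its prefixes) do.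
\<close>

definition paths_above :: "nat \<Rightarrow> nat \<Rightarrow> step set \<Rightarrow> step list set" where
  "paths_above n k A = {p. set p \<subseteq> A \<and> path_x k p = k * n \<and> path_y p = n \<and>
     (\<forall>i\<le>length p. real (path_y (take i p)) \<ge> real (path_x k (take i p)) / real k)}"

definition Dyck :: "nat \<Rightarrow> nat \<Rightarrow> step list set" where
  "Dyck n k = paths_above n k {U, D}"

definition SchA :: "nat \<Rightarrow> nat \<Rightarrow> step list set" where
  "SchA n k = paths_above n k {U, D, H}"

definition up_positions :: "step list \<Rightarrow> nat set" where
  "up_positions p = {i. i < length p \<and> p ! i = U}"

definition two_coloured_Dyck :: "nat \<Rightarrow> nat \<Rightarrow> (step list \<times> (nat \<Rightarrow> bool)) set" where
  "two_coloured_Dyck n k = (SIGMA p:Dyck n k. up_positions p \<rightarrow>\<^sub>E (UNIV :: bool set))"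

definition begins_UDk :: "nat \<Rightarrow> step list \<Rightarrow> nat \<Rightarrow> bool" where
  "begins_UDk k p i \<longleftrightarrow> take (Suc k) (drop i p) = U # replicate k D"

definition weight :: "nat \<Rightarrow> step list \<Rightarrow> nat" where
  "weight k p = (\<Prod>i\<in>up_positions p. if begins_UDk k p i then 4 else 3)"

end

theory Submission
  imports Defs
begin

text \<open>
  At \<open>s = 1\<close> the series \<open>G(x) = \<nu>(-x)\<close> satisfies \<open>G = 1 + m' x G + c x G\<^bsup>k+1\<^esup>\<close> with
  \<open>c = (m' + 1) u' + 1\<close>. Multiplying by \<open>G\<^sup>h\<close> shows that the coefficients
  \<open>a h n = [x\<^sup>n] G\<^bsup>h+1\<^esup>\<close> obey a recursion which determines them. Removing the first step of a
  path gives the same recursion for the paths from height \<open>h\<close> down to height \<open>0\<close>, where the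
  height of \<open>(x, y)\<close> is \<open>k y - x\<close>, so no decomposition at the returns to the axis is needed.
  For the weights \<open>4\<close> and \<open>3\<close>, a first step \<open>U\<close> contributes \<open>3\<close> times the
  paths from height \<open>h + k\<close>, and the excess \<open>1\<close> of an initial \<open>U D\<^sup>k\<close> contributes the
  paths from height \<open>h\<close>; hence \<open>m' = 1\<close> and \<open>c = 3\<close>.
\<close>

section \<open>The recursion in height and size\<close>

text \<open>The first term drops out at \<open>h = 0\<close> on both sides: \<open>G^0 = 1\<close>
  has no coefficient of positive index, and no path starts down from height 0.\<close>

definition ballot_recursion ::
    "nat \<Rightarrow> 'a::comm_semiring_1 \<Rightarrow> 'a \<Rightarrow> (nat \<Rightarrow> nat \<Rightarrow> 'a) \<Rightarrow> bool" where
  "ballot_recursion k m c a \<longleftrightarrow> (\<forall>h. a h 0 = 1) \<and>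
     (\<forall>h n. a h (Suc n) =
        (if h = 0 then 0 else a (h - 1) (Suc n)) + m * a h n + c * a (h + k) n)"

lemma ballot_recursion_0: "ballot_recursion k m c a \<Longrightarrow> a h 0 = 1"
  by (simp add: ballot_recursion_def)

lemma ballot_recursion_Suc:
  "ballot_recursion k m c a \<Longrightarrow>
     a h (Suc n) = (if h = 0 then 0 else a (h - 1) (Suc n)) + m * a h n + c * a (h + k) n"
  unfolding ballot_recursion_def by blast

text \<open>The recursion descends lexicographically: it refers to smaller \<open>n\<close> at any
  height, or to the same \<open>n\<close> at a lower height. Hence an induction on \<open>h\<close>
  inside one on \<open>n\<close>.\<close>

lemma ballot_recursion_unique:
  assumes a: "ballot_recursion k m c a" and b: "ballot_recursion k m c b"
  shows "a h n = b h n"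
proof (induction n arbitrary: h)
  case 0
  then show ?case using assms by (simp add: ballot_recursion_0)
next
  case IH: (Suc n)
  show ?case
    by (induction h)
      (subst ballot_recursion_Suc[OF a], subst ballot_recursion_Suc[OF b], simp add: IH)+
qed

lemma ballot_recursion_of_nat:
  assumes "ballot_recursion k m c a"
  shows "ballot_recursion k (of_nat m) (of_nat c) (\<lambda>h n. of_nat (a h n))"
  using assms unfolding ballot_recursion_def by simp

text \<open>The term with \<open>c\<close> lowers \<open>n\<close> by one, so it absorbs one factor
  \<open>d\<close>; the term with \<open>h - 1\<close> keeps \<open>n\<close>.\<close>

lemma ballot_recursion_scale:
  assumes "ballot_recursion k 0 c a"
  shows "ballot_recursion k 0 (d * c) (\<lambda>h n. d ^ n * a h n)"
  using assms unfolding ballot_recursion_def by (simp add: algebra_simps)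

section \<open>Coefficients of powers of the series\<close>

lemma ballot_recursion_nu:
  fixes m' u' :: "'a::comm_ring_1"
  shows "ballot_recursion k m' ((m' + 1) * u' + 1)
           (\<lambda>h n. (-1) ^ n * fps_nth (nu k (m' + 1) 1 (u' + 1) ^ Suc h) n)"
proof -
  define F where "F = nu k (m' + 1) 1 (u' + 1)"
  define c where "c = (m' + 1) * u' + 1"
  have "F = nu_step k (m' + 1) 1 (u' + 1) F"
    using nu_equation_nu unfolding F_def nu_equation_iff_fixpoint by blast
  \<comment> \<open>At \<open>s = 1\<close> all \<open>k + 1\<close> factors of the product equal
    \<open>F\<close>.\<close>
  then have F: "F = 1 - fps_X * (fps_const m' * F + fps_const c * F ^ Suc k)"
    by (simp add: nu_step_def c_def)
  have pow: "F ^ Suc h = F ^ h - fps_X * (fps_const m' * F ^ Suc h + fps_const c * F ^ (Suc (h + k)))"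
    for h
  proof -
    have "F ^ h * F = F ^ h * (1 - fps_X * (fps_const m' * F + fps_const c * F ^ Suc k))"
      using F by simp
    then show ?thesis by (simp add: algebra_simps power_add)
  qed
  have F0: "fps_nth F 0 = 1" by (subst F) simp
  have rec: "fps_nth (F ^ Suc h) (Suc n) = fps_nth (F ^ h) (Suc n)
      - m' * fps_nth (F ^ Suc h) n - c * fps_nth (F ^ Suc (h + k)) n" for h n
    by (subst pow) (simp del: power_Suc)
  have zero: "fps_nth (F ^ Suc h) 0 = 1" for h
    using F0 by (simp add: fps_power_zeroth)
  \<comment> \<open>Passing from \<open>n\<close> to \<open>Suc n\<close> flips the sign, which
    makes both subtracted terms positive.\<close>
  have "(-1) ^ Suc n * fps_nth (F ^ Suc h) (Suc n) =
      (if h = 0 then 0 else (-1) ^ Suc n * fps_nth (F ^ Suc (h - 1)) (Suc n))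
      + m' * ((-1) ^ n * fps_nth (F ^ Suc h) n) + c * ((-1) ^ n * fps_nth (F ^ Suc (h + k)) n)"
    for h n
    by (cases h; simp only: rec; simp del: power_Suc add: algebra_simps power_Suc[of "-1"])
  then show ?thesis
    unfolding ballot_recursion_def F_def[symmetric] c_def[symmetric] by (auto simp: zero simp del: power_Suc)
qed

lemma S_num_eq_ballot:
  assumes "ballot_recursion k m' ((m' + 1) * u' + 1) a"
  shows "S_num k n m' u' = a 0 n"
  using ballot_recursion_unique[OF ballot_recursion_nu assms, where h = 0 and n = n] by (simp add: S_num_def)

text \<open>The closed form of \<open>[x\<^sup>n] G\<^bsup>h+1\<^esup>\<close> for \<open>G = 1 + x G\<^bsup>k+1\<^esup>\<close>.\<close>

lemma ballot_recursion_Fuss_Catalan: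
  "ballot_recursion k 0 1
     (\<lambda>h n. real (Suc h) / real (Suc h + (k + 1) * n) * real ((Suc h + (k + 1) * n) choose n))"
proof -
  \<comment> \<open>For positive \<open>n\<close>, \<open>b h n\<close> belongs to
    \<open>G^h\<close> rather than \<open>G^(h+1)\<close>, so the boundary case is just
    \<open>b 0 (Suc n) = 0\<close>.\<close>
  define b where "b h n = real h / real (h + (k + 1) * n) * real ((h + (k + 1) * n) choose n)" for h n
  have step: "b (Suc h) (Suc n) = b h (Suc n) + b (Suc h + k) n" for h n
  proof -
    \<comment> \<open>All three binomials have top \<open>M\<close> or \<open>Suc M\<close> and
      reduce to rational multiples of \<open>B\<close>; a rational identity remains.\<close>
    define M where "M = h + k + (k + 1) * n + 1"
    define B where "B = real (M choose n)"
    have M: "Suc h + (k + 1) * Suc n = Suc M" "h + (k + 1) * Suc n = M" "Suc h + k + (k + 1) * n = M"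
      by (simp_all add: M_def)
    have Mpos: "real M > 0" unfolding of_nat_0_less_iff by (simp add: M_def)
    have "Suc n * (Suc M choose Suc n) = Suc M * (M choose n)"
      by (rule Suc_times_binomial_eq[symmetric, unfolded mult.commute[of "_ choose _"]])
    then have "real (Suc n) * real (Suc M choose Suc n) = real (Suc M) * B"
      unfolding B_def by (metis of_nat_mult)
    then have e1: "real (Suc M choose Suc n) = real (Suc M) / real (Suc n) * B"
      by (simp add: field_simps del: of_nat_Suc binomial_Suc_Suc)
    have e2: "real (M choose Suc n) = real (Suc M choose Suc n) - B"
      by (simp add: B_def)
    have "b (Suc h) (Suc n) = real (Suc h) / real (Suc n) * B"
      unfolding b_def M e1 by simp
    moreover have "b h (Suc n) = real h / real M * (real (Suc M) / real (Suc n) * B - B)"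
      unfolding b_def M e2 e1 ..
    moreover have "b (Suc h + k) n = real (Suc h + k) / real M * B"
      unfolding b_def M B_def by simp
    moreover have "real (Suc h) / real (Suc n) =
        real h / real M * (real (Suc M) / real (Suc n) - 1) + real (Suc h + k) / real M"
      using Mpos by (simp add: divide_simps) (simp add: M_def algebra_simps)
    ultimately show ?thesis
      by (simp add: algebra_simps del: of_nat_Suc)
  qed
  have "b 0 (Suc n) = 0" for n by (simp add: b_def)
  then have "b (Suc h) (Suc n) = (if h = 0 then 0 else b (Suc (h - 1)) (Suc n)) + b (Suc (h + k)) n" for h n
    using step[of h n] by simp
  then show ?thesis
    unfolding ballot_recursion_def b_def by simp
qed

section \<open>Paths by starting height\<close>

text \<open>The argument \<open>h\<close> is the current height \<open>k * y - x\<close>, which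
  \<open>H\<close> preserves. Recursion on the steps replaces the quantifier over prefixes.\<close>

fun descends :: "nat \<Rightarrow> nat \<Rightarrow> step list \<Rightarrow> bool" where
  "descends k h [] \<longleftrightarrow> h = 0"
| "descends k h (U # p) \<longleftrightarrow> descends k (h + k) p"
| "descends k h (D # p) \<longleftrightarrow> h > 0 \<and> descends k (h - 1) p"
| "descends k h (H # p) \<longleftrightarrow> descends k h p"

definition paths_from :: "nat \<Rightarrow> step set \<Rightarrow> nat \<Rightarrow> nat \<Rightarrow> step list set" where
  "paths_from k A h n = {p. set p \<subseteq> A \<and> descends k h p \<and> path_y p = n}"

lemma path_x_simps [simp]:
  "path_x k [] = 0" "path_x k (x # p) = step_x k x + path_x k p"
  by (simp_all add: path_x_def)

lemma path_y_simps [simp]: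
  "path_y [] = 0" "path_y (x # p) = step_y x + path_y p"
  by (simp_all add: path_y_def)

lemma descends_iff:
  "descends k h p \<longleftrightarrow> path_x k p = h + k * path_y p \<and>
     (\<forall>i\<le>length p. path_x k (take i p) \<le> h + k * path_y (take i p))"
proof (induction p arbitrary: h)
  case (Cons x p)
  have all: "(\<forall>i\<le>Suc l. Q i) \<longleftrightarrow> Q 0 \<and> (\<forall>i\<le>l. Q (Suc i))" for Q :: "nat \<Rightarrow> bool" and l
    by (metis Suc_le_mono not0_implies_Suc zero_le)
  show ?case
  proof (cases x)
    case D
    then show ?thesis
      \<comment> \<open>The prefix consisting of this single \<open>D\<close> rules out
        \<open>h = 0\<close>.\<close>
      by (cases h) (auto simp: all Cons.IH dest: spec[of _ "0::nat"])
  qed (auto simp: all Cons.IH algebra_simps)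
qed auto

lemma paths_above_eq_paths_from:
  assumes "k \<ge> 1"
  shows "paths_above n k A = paths_from k A 0 n"
proof -
  have "real x / real k \<le> real y \<longleftrightarrow> x \<le> k * y" for x y
    using assms by (simp add: divide_le_eq mult.commute flip: of_nat_mult)
  then show ?thesis
    unfolding paths_above_def paths_from_def descends_iff by auto
qed

lemma paths_from_0:
  assumes "D \<in> A"
  shows "paths_from k A h 0 = {replicate h D}"
proof -
  have eq: "descends k h p \<and> path_y p = 0 \<longleftrightarrow> p = replicate h D" for p
  proof (induction p arbitrary: h)
    case (Cons x p)
    then show ?case by (cases x; cases h) auto
  qed auto
  show ?thesis unfolding paths_from_def eq using assms by auto
qed

lemma paths_from_Suc:
  assumes "U \<in> A" "D \<in> A"
  shows "paths_from k A h (Suc n) =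
    (if h = 0 then {} else (#) D ` paths_from k A (h - 1) (Suc n)) \<union>
    (if H \<in> A then (#) H ` paths_from k A h n else {}) \<union> (#) U ` paths_from k A (h + k) n"
    (is "?L = ?R")
proof (rule set_eqI)
  fix p
  show "p \<in> ?L \<longleftrightarrow> p \<in> ?R"
  proof (cases p)
    case (Cons x q)
    then show ?thesis
      using assms by (cases x) (auto simp: paths_from_def)
  qed (auto simp: paths_from_def)
qed

lemma finite_paths_from:
  assumes "U \<in> A" "D \<in> A"
  shows "finite (paths_from k A h n)"
proof (induction n arbitrary: h)
  case 0
  then show ?case using assms by (simp add: paths_from_0)
next
  case IH: (Suc n)
  show ?case
    using IH by (induction h) (simp_all add: paths_from_Suc[OF assms])
qed

text \<open>An arbitrary \<open>w\<close> serves both cardinalities (\<open>w\<close> constantly 1)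
  and weighted counts.\<close>

lemma sum_paths_from_Suc:
  assumes "U \<in> A" "D \<in> A"
  shows "sum w (paths_from k A h (Suc n)) =
    (if h = 0 then 0 else \<Sum>p\<in>paths_from k A (h - 1) (Suc n). w (D # p)) +
    (if H \<in> A then \<Sum>p\<in>paths_from k A h n. w (H # p) else 0) +
    (\<Sum>p\<in>paths_from k A (h + k) n. w (U # p))"
proof -
  have cons: "sum w ((#) x ` B) = (\<Sum>p\<in>B. w (x # p))" for x and B :: "step list set"
    by (subst sum.reindex) (auto simp: inj_on_def)
  define X where "X = (if h = 0 then {} else (#) D ` paths_from k A (h - 1) (Suc n))"
  define Y where "Y = (if H \<in> A then (#) H ` paths_from k A h n else {})"
  define Z where "Z = (#) U ` paths_from k A (h + k) n"
  have fin: "finite X" "finite Y" "finite Z"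
    by (simp_all add: X_def Y_def Z_def finite_paths_from[OF assms])
  have "(X \<union> Y) \<inter> Z = {}" "X \<inter> Y = {}"
    by (auto simp: X_def Y_def Z_def)
  then have "sum w (X \<union> Y \<union> Z) = sum w X + sum w Y + sum w Z"
    using fin by (simp add: sum.union_disjoint)
  moreover have "sum w X = (if h = 0 then 0 else \<Sum>p\<in>paths_from k A (h - 1) (Suc n). w (D # p))"
    by (simp add: X_def cons)
  moreover have "sum w Y = (if H \<in> A then \<Sum>p\<in>paths_from k A h n. w (H # p) else 0)"
    by (simp add: Y_def cons)
  moreover have "sum w Z = (\<Sum>p\<in>paths_from k A (h + k) n. w (U # p))"
    by (simp add: Z_def cons)
  moreover have "paths_from k A h (Suc n) = X \<union> Y \<union> Z"
    unfolding X_def Y_def Z_def by (rule paths_from_Suc[OF assms])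
  ultimately show ?thesis
    by (simp only:)
qed

lemma ballot_recursion_Dyck:
  "ballot_recursion k 0 1 (\<lambda>h n. card (paths_from k {U, D} h n))"
  unfolding ballot_recursion_def card_eq_sum
  by (intro conjI allI; (subst sum_paths_from_Suc)?) (simp_all add: paths_from_0)

text \<open>A first \<open>H\<close> keeps the height and uses one unit of size, which accounts for
  \<open>m = 1\<close>.\<close>

lemma ballot_recursion_SchA:
  "ballot_recursion k 1 1 (\<lambda>h n. card (paths_from k {U, D, H} h n))"
  unfolding ballot_recursion_def card_eq_sum
  by (intro conjI allI; (subst sum_paths_from_Suc)?) (simp_all add: paths_from_0)

section \<open>Weights of up steps\<close>

lemma up_positions_Cons:
  "up_positions (x # p) = (if x = U then {0} else {}) \<union> Suc ` up_positions p"
proof (rule set_eqI)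
  fix i
  show "i \<in> up_positions (x # p) \<longleftrightarrow> i \<in> (if x = U then {0} else {}) \<union> Suc ` up_positions p"
    by (cases i) (auto simp: up_positions_def)
qed

lemma finite_up_positions [simp]: "finite (up_positions p)"
  by (simp add: up_positions_def)

lemma weight_Nil [simp]: "weight k [] = 1"
  by (simp add: weight_def up_positions_def)

lemma weight_Cons:
  "weight k (x # p) =
     (if x = U then if take k p = replicate k D then 4 else 3 else 1) * weight k p"
proof -
  have "(\<Prod>i\<in>Suc ` up_positions p. if begins_UDk k (x # p) i then 4 else 3) = weight k p"
    unfolding weight_def by (subst prod.reindex) (auto simp: begins_UDk_def intro!: prod.cong)
  then show ?thesis
    unfolding weight_def[of k "x # p"] up_positions_Cons
    by (auto simp: begins_UDk_def)
qed

lemma weight_replicate_D_append: "weight k (replicate j D @ p) = weight k p"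
  by (induction j) (simp_all add: weight_Cons)

lemma descends_replicate_D_append: "descends k (h + j) (replicate j D @ p) = descends k h p"
  by (induction j) simp_all

lemma path_y_replicate_D_append: "path_y (replicate j D @ p) = path_y p"
  by (induction j) simp_all

text \<open>Used with \<open>j = k\<close>: the rest of a path after an initial \<open>U D^k\<close>
  is an arbitrary path from the original height.\<close>

lemma paths_from_beginning_with_downs:
  assumes "D \<in> A"
  shows "{p \<in> paths_from k A (h + j) n. take j p = replicate j D} =
         (@) (replicate j D) ` paths_from k A h n"
proof -
  have "p \<in> (@) (replicate j D) ` paths_from k A h n"
    if p: "p \<in> paths_from k A (h + j) n" "take j p = replicate j D" for p
  proof -
    have "p = replicate j D @ drop j p"
      using p(2) by (metis append_take_drop_id)
    moreover from this have "drop j p \<in> paths_from k A h n"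
      using p(1) descends_replicate_D_append[of k h j "drop j p"]
        path_y_replicate_D_append[of j "drop j p"] set_drop_subset[of j p]
      by (auto simp: paths_from_def)
    ultimately show ?thesis by blast
  qed
  then show ?thesis
    using assms
    by (auto simp: paths_from_def descends_replicate_D_append path_y_replicate_D_append)
qed

lemma ballot_recursion_weight:
  "ballot_recursion k 1 3 (\<lambda>h n. \<Sum>p\<in>paths_from k {U, D} h n. weight k p)"
proof -
  have U: "(\<Sum>p\<in>paths_from k {U, D} (h + k) n. weight k (U # p)) =
      (\<Sum>p\<in>paths_from k {U, D} h n. weight k p) +
      3 * (\<Sum>p\<in>paths_from k {U, D} (h + k) n. weight k p)" for h n
  proof -
    let ?P = "paths_from k {U, D} (h + k) n"
    \<comment> \<open>Weight 4 is split as 1 + 3, so that 3 is common to every first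
      \<open>U\<close>.\<close>
    have "(\<Sum>p\<in>?P. weight k (U # p)) =
        (\<Sum>p\<in>?P. if take k p = replicate k D then weight k p else 0) + 3 * (\<Sum>p\<in>?P. weight k p)"
      unfolding sum_distrib_left sum.distrib[symmetric]
      by (intro sum.cong) (auto simp: weight_Cons)
    also have "(\<Sum>p\<in>?P. if take k p = replicate k D then weight k p else 0) =
        (\<Sum>p\<in>{p \<in> ?P. take k p = replicate k D}. weight k p)"
      by (intro sum.inter_filter[symmetric] finite_paths_from) auto
    also have "\<dots> = (\<Sum>p\<in>paths_from k {U, D} h n. weight k p)"
      by (simp add: paths_from_beginning_with_downs sum.reindex inj_on_def weight_replicate_D_append)
    finally show ?thesis .
  qed
  show ?thesis
    unfolding ballot_recursion_def
    by (intro conjI allI; (subst sum_paths_from_Suc)?)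
      \<comment> \<open>With the empty tail, this gives the only path of size 0, all downs, weight
        1.\<close>
      (use weight_replicate_D_append[of k _ "[]"] in \<open>simp_all add: paths_from_0 U, simp_all add: weight_Cons\<close>)
qed

section \<open>Colourings and the four evaluations\<close>

lemma card_up_positions: "H \<notin> set p \<Longrightarrow> card (up_positions p) = path_y p"
proof (induction p)
  case (Cons x p)
  have "card (up_positions (x # p)) = (if x = U then 1 else 0) + card (up_positions p)"
    unfolding up_positions_Cons by (subst card_Un_disjoint) (auto simp: card_image)
  then show ?case using Cons by (cases x) auto
qed (simp add: up_positions_def)

lemma card_two_coloured_Dyck:
  assumes "k \<ge> 1"
  shows "card (two_coloured_Dyck n k) = 2 ^ n * card (Dyck n k)"
proof -
  \<comment> \<open>Without \<open>H\<close>, the final ordinate \<open>n\<close> counts the up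
    steps.\<close>
  have "card (up_positions p \<rightarrow>\<^sub>E (UNIV :: bool set)) = 2 ^ n" if "p \<in> Dyck n k" for p
  proof -
    have "H \<notin> set p" "path_y p = n"
      using that by (auto simp: Dyck_def paths_above_def)
    then show ?thesis by (simp add: card_PiE card_up_positions)
  qed
  moreover have "finite (Dyck n k)"
    using assms by (simp add: Dyck_def paths_above_eq_paths_from finite_paths_from)
  ultimately show ?thesis
    unfolding two_coloured_Dyck_def by (subst card_SigmaI) (auto intro!: finite_PiE)
qed

theorem proposition4p18:
  fixes k n :: nat
  assumes "k \<ge> 1"
  shows "S_num k n (0::int) 0 = int (card (Dyck n k))
       \<and> real (card (Dyck n k)) = 1 / real (k * n + 1) * real (((k + 1) * n) choose n)
       \<and> S_num k n (0::int) 1 = 2 ^ n * int (card (Dyck n k))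
       \<and> S_num k n (0::int) 1 = int (card (two_coloured_Dyck n k))
       \<and> S_num k n (1::int) 0 = int (card (SchA n k))
       \<and> S_num k n (1::int) 1 = int (\<Sum>p\<in>Dyck n k. weight k p)"
proof -
  have Dyck: "Dyck n k = paths_from k {U, D} 0 n" and SchA: "SchA n k = paths_from k {U, D, H} 0 n"
    using assms by (simp_all add: Dyck_def SchA_def paths_above_eq_paths_from)
  have dyck: "ballot_recursion k (0::int) 1 (\<lambda>h n. int (card (paths_from k {U, D} h n)))"
    using ballot_recursion_of_nat[OF ballot_recursion_Dyck[of k]] by simp
  \<comment> \<open>For \<open>(m', u')\<close> equal to (0,0), (0,1), (1,0), (1,1), the coefficient
    \<open>(m' + 1) * u' + 1\<close> is 1, 2, 1, 3.\<close>
  have S00: "S_num k n (0::int) 0 = int (card (Dyck n k))"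
    unfolding Dyck by (rule S_num_eq_ballot) (simp add: dyck)
  have S01: "S_num k n (0::int) 1 = 2 ^ n * int (card (Dyck n k))"
    unfolding Dyck by (rule S_num_eq_ballot) (use ballot_recursion_scale[OF dyck, of 2] in simp)
  have S10: "S_num k n (1::int) 0 = int (card (SchA n k))"
    unfolding SchA
    by (rule S_num_eq_ballot) (use ballot_recursion_of_nat[OF ballot_recursion_SchA[of k]] in simp)
  have S11: "S_num k n (1::int) 1 = int (\<Sum>p\<in>Dyck n k. weight k p)"
    unfolding Dyck
    by (rule S_num_eq_ballot) (use ballot_recursion_of_nat[OF ballot_recursion_weight[of k]] in simp)
  have "ballot_recursion k (0::real) 1 (\<lambda>h n. real (card (paths_from k {U, D} h n)))"
    using ballot_recursion_of_nat[OF ballot_recursion_Dyck[of k]] by simp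
  from ballot_recursion_unique[OF this ballot_recursion_Fuss_Catalan, where h = 0 and n = n]
  have "real (card (Dyck n k)) =
      1 / real (Suc ((k + 1) * n)) * real (Suc ((k + 1) * n) choose n)"
    by (simp add: Dyck)
  also have "\<dots> = 1 / real (k * n + 1) * real (((k + 1) * n) choose n)"
  proof -
    \<comment> \<open>Absorption lowers the top of the binomial by one; the factor
      \<open>(k + 1) * n + 1 - n\<close> is \<open>k * n + 1\<close>.\<close>
    have "(Suc ((k + 1) * n) - n) * (Suc ((k + 1) * n) choose n) = Suc ((k + 1) * n) * ((k + 1) * n choose n)"
      using binomial_absorb_comp[of "Suc ((k + 1) * n)" n] by simp
    then have "(k * n + 1) * (Suc ((k + 1) * n) choose n) = Suc ((k + 1) * n) * ((k + 1) * n choose n)"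
      by simp
    then have "real (k * n + 1) * real (Suc ((k + 1) * n) choose n) =
        real (Suc ((k + 1) * n)) * real ((k + 1) * n choose n)"
      by (metis of_nat_mult)
    then show ?thesis
      by (simp add: divide_simps del: of_nat_Suc) (simp add: algebra_simps)
  qed
  finally show ?thesis
    using S00 S01 S10 S11 card_two_coloured_Dyck[OF assms, of n] by simp
qed

end
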